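(* Let $(X,\mathsf d,\mu)$ be a proper metric measure space, let $\Omega\subseteq X$ be a bounded domain, and let $u\in L^1_{\mathrm{loc}}(\Omega,\mu)$ be a lower semicontinuous function in $\overline\Omega$ such that $\underline\Delta{}_\mu^{\mathsf d}u\le0$ in $\Omega$. Assume that there exists a bounded function $\phi$ which is upper semicontinuous in $\overline\Omega$ and such that $\underline\Delta{}_\mu^{\mathsf d}\phi>0$ in $\Omega$. Then $$\min_{\partial\Omega}u=\min_{\overline\Omega}u.$$
   Context: A metric measure space $(X,\mathsf d,\mu)$ is a metric space with a Borel measure $\mu$ such that $\mu(U)>0$ for every non-empty open $U\subset X$ (balls are understood to have finite measure so that averages over balls make sense). It is proper if all closed bounded subsets are compact. A domain is a non-empty connected open set. Functions may take values in $\overline{\mathbb R}=[-\infty,+\infty]$. Convention: a function $u\in L^1_{\mathrm{loc}}$ is evaluated pointwise through its representative whose value at $x$ is $\lim_{r\to0^+}\mu(B_r(x))^{-1}\int_{B_r(x)}u\,d\mu$ whenever this limit exists. With $B_r(x)$ the ball of center $x$ and radius $r$, the lower AMV (asymptotic mean value) Laplacian is, for $x\in\Omega$, $$\underline\Delta{}_\mu^{\mathsf d}u(x):=\liminf_{r\to0^+}\frac1{r^2}\,\frac1{\mu(B_r(x))}\int_{B_r(x)}\big(u(y)-u(x)\big)\,d\mu(y).$$ Inequalities "in $\Omega$" are meant at every point of $\Omega$. *)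

theory Defs
  imports "HOL-Analysis.Analysis"
begin

text \<open>The metric space is the whole type; \<open>M\<close> is the measure on it.\<close>

definition metric_measure_space :: "'a::metric_space measure \<Rightarrow> bool" where
  "metric_measure_space M \<longleftrightarrow>
     sets M = sets borel \<and>
     (\<forall>U. open U \<and> U \<noteq> {} \<longrightarrow> emeasure M U > 0) \<and>
     (\<forall>x r. emeasure M (ball x r) < \<infinity>)"

definition proper_space :: "'a::metric_space itself \<Rightarrow> bool" where
  "proper_space _ \<longleftrightarrow> (\<forall>S::'a set. closed S \<and> bounded S \<longrightarrow> compact S)"

definition domain :: "'a::topological_space set \<Rightarrow> bool" where
  "domain \<Omega> \<longleftrightarrow> \<Omega> \<noteq> {} \<and> open \<Omega> \<and> connected \<Omega>"

definition lsc_on :: "'a::topological_space set \<Rightarrow> ('a \<Rightarrow> ereal) \<Rightarrow> bool" where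
  "lsc_on S u \<longleftrightarrow> (\<forall>x\<in>S. u x \<le> Liminf (at x within S) u)"

definition usc_on :: "'a::topological_space set \<Rightarrow> ('a \<Rightarrow> ereal) \<Rightarrow> bool" where
  "usc_on S u \<longleftrightarrow> (\<forall>x\<in>S. Limsup (at x within S) u \<le> u x)"

definition L1_loc :: "'a::topological_space measure \<Rightarrow> 'a set \<Rightarrow> ('a \<Rightarrow> ereal) \<Rightarrow> bool" where
  "L1_loc M \<Omega> u \<longleftrightarrow>
     u \<in> borel_measurable (restrict_space M \<Omega>) \<and>
     (\<forall>K. compact K \<and> K \<subseteq> \<Omega> \<longrightarrow> (\<integral>\<^sup>+y\<in>K. e2ennreal \<bar>u y\<bar> \<partial>M) < \<infinity>)"

text \<open>
  The integral of an extended real valued function is the integral of its positive part minus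
  that of its negative part; \<open>e2ennreal\<close> truncates at 0. The clash \<open>\<infinity> - \<infinity>\<close> (which is \<open>\<infinity>\<close>
  in \<^typ>\<open>ereal\<close>) plays no role below: if \<open>u\<close> is locally integrable, then over a small ball at
  most one of the two parts of \<open>u - u x\<close> has infinite integral, and this happens only when
  \<open>u x\<close> is infinite.
\<close>

definition ball_mean :: "'a::metric_space measure \<Rightarrow> ('a \<Rightarrow> ereal) \<Rightarrow> 'a \<Rightarrow> real \<Rightarrow> ereal" where
  "ball_mean M f x r =
     ereal (1 / measure M (ball x r)) *
       (enn2ereal (\<integral>\<^sup>+y\<in>ball x r. e2ennreal (f y) \<partial>M)
        - enn2ereal (\<integral>\<^sup>+y\<in>ball x r. e2ennreal (- f y) \<partial>M))"

definition lower_amv_laplacian :: "'a::metric_space measure \<Rightarrow> ('a \<Rightarrow> ereal) \<Rightarrow> 'a \<Rightarrow> ereal" where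
  "lower_amv_laplacian M u x =
     Liminf (at_right 0) (\<lambda>r. ereal (1 / r\<^sup>2) * ball_mean M (\<lambda>y. u y - u x) x r)"

text \<open>
  The convention on pointwise values of locally integrable functions: \<open>u\<close> is the representative
  given by the limits of its ball averages wherever they exist. For lower semicontinuous \<open>u\<close> with
  lower Laplacian at most 0, and for bounded upper semicontinuous \<open>u\<close> with positive lower
  Laplacian, this holds automatically: semicontinuity gives one inequality between \<open>u x\<close> and the
  limit, the sign of the Laplacian the other.
\<close>

definition precise_on :: "'a::metric_space measure \<Rightarrow> 'a set \<Rightarrow> ('a \<Rightarrow> ereal) \<Rightarrow> bool" where
  "precise_on M \<Omega> u \<longleftrightarrow>
     (\<forall>x\<in>\<Omega>. \<forall>l. (ball_mean M u x \<longlongrightarrow> l) (at_right 0) \<longrightarrow> u x = l)"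

end

theory Submission
  imports Defs
begin

text \<open>
  The minimum of \<open>u\<close> over the compact set \<open>closure \<Omega>\<close> is attained by lower semicontinuity. Suppose
  that no frontier point attains it. As \<open>\<phi>\<close> is bounded, subtracting a small multiple of \<open>\<phi>\<close> keeps
  the frontier values above the minimum, so the lower semicontinuous function \<open>u - \<epsilon> \<phi>\<close> attains its
  minimum over \<open>closure \<Omega>\<close> at a point \<open>x\<close> of \<open>\<Omega>\<close> itself. Minimality means that
  \<open>u y - u x \<ge> \<epsilon> (\<phi> y - \<phi> x)\<close> for all \<open>y\<close> in \<open>\<Omega>\<close>, i.e. \<open>u\<close> is touched from below at \<open>x\<close> by a
  translate of \<open>\<epsilon> \<phi>\<close>. Ball means are monotone and positively homogeneous, so the Laplacian of
  \<open>u\<close> at \<open>x\<close> is at least a positive multiple of a positive number (\<open>touching_laplacian_pos\<close>), which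
  contradicts the hypothesis on \<open>u\<close>.

  Infinite values fit into the same scheme. If the minimum of \<open>u\<close> is infinite and attained at
  \<open>x \<in> \<Omega>\<close>, then \<open>u y - u x = \<infinity>\<close> for all \<open>y\<close> (because \<open>\<infinity> - \<infinity> = \<infinity>\<close> in \<^typ>\<open>ereal\<close>), so \<open>u\<close> is
  touched from below by every function. The case of an empty frontier needs no separate treatment:
  the argument then shows that it cannot occur.
\<close>

lemma lsc_on_iff_eventually_less:
  "lsc_on S u \<longleftrightarrow> (\<forall>x\<in>S. \<forall>a<u x. \<forall>\<^sub>F y in at x within S. a < u y)"
  by (simp add: lsc_on_def le_Liminf_iff)

lemma usc_on_iff_eventually_less:
  "usc_on S u \<longleftrightarrow> (\<forall>x\<in>S. \<forall>a>u x. \<forall>\<^sub>F y in at x within S. u y < a)"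
  by (simp add: usc_on_def Limsup_le_iff)

text \<open>
  If there were no minimum, each \<open>x\<close> would have some \<open>y x\<close> in \<open>S\<close> with \<open>u (y x) < u x\<close>, and hence,
  by semicontinuity, \<open>u (y x) < u\<close> on a neighbourhood of \<open>x\<close>. Finitely many of these neighbourhoods
  cover \<open>S\<close>, and the least of the corresponding values \<open>u (y x)\<close> lies above another one.
\<close>
lemma lsc_on_compact_attains_min:
  assumes S: "compact S" "S \<noteq> {}" and u: "lsc_on S u"
  obtains x where "x \<in> S" "\<And>z. z \<in> S \<Longrightarrow> u x \<le> u z"
proof (rule ccontr)
  assume "\<not> thesis"
  then have "\<forall>x\<in>S. \<exists>y\<in>S. u y < u x"
    using that by (meson not_le)
  then obtain y where y: "\<And>x. x \<in> S \<Longrightarrow> y x \<in> S" "\<And>x. x \<in> S \<Longrightarrow> u (y x) < u x"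
    by metis
  have "\<exists>T. open T \<and> x \<in> T \<and> (\<forall>z\<in>T \<inter> S. u (y x) < u z)" if x: "x \<in> S" for x
  proof -
    have "\<forall>\<^sub>F z in at x within S. u (y x) < u z"
      using u x y(2)[OF x] by (auto simp: lsc_on_iff_eventually_less)
    then obtain T where "open T" "x \<in> T" "\<forall>z\<in>T. z \<noteq> x \<longrightarrow> z \<in> S \<longrightarrow> u (y x) < u z"
      unfolding eventually_at_topological by auto
    then show ?thesis
      using y(2)[OF x] by (intro exI[of _ T]) auto
  qed
  then obtain T where T: "\<And>x. x \<in> S \<Longrightarrow> open (T x)" "\<And>x. x \<in> S \<Longrightarrow> x \<in> T x"
      "\<And>x z. x \<in> S \<Longrightarrow> z \<in> T x \<Longrightarrow> z \<in> S \<Longrightarrow> u (y x) < u z"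
    by (metis IntI)
  obtain F where F: "F \<subseteq> S" "finite F" "S \<subseteq> (\<Union>x\<in>F. T x)"
    by (rule compactE_image[of S S T]) (use S(1) T(1,2) in auto)
  have "F \<noteq> {}"
    using F(3) S(2) by auto
  with F(2) obtain x where x: "x \<in> F" "\<And>z. z \<in> F \<Longrightarrow> u (y x) \<le> u (y z)"
    using ex_is_arg_min_if_finite[of F "\<lambda>x. u (y x)"] by (auto simp: is_arg_min_linorder)
  have "y x \<in> S"
    using y(1) x(1) F(1) by auto
  then obtain z where "z \<in> F" "y x \<in> T z"
    using F(3) by auto
  then have "u (y z) < u (y x)"
    using T(3) F(1) \<open>y x \<in> S\<close> by auto
  with x(2)[OF \<open>z \<in> F\<close>] show False
    by simp
qed

lemma lsc_on_subset:
  assumes "lsc_on S u" "T \<subseteq> S"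
  shows "lsc_on T u"
proof -
  have "at x within T \<le> at x within S" for x
    using assms(2) by (rule at_le)
  then have "\<forall>\<^sub>F y in at x within T. P y" if "\<forall>\<^sub>F y in at x within S. P y" for x P
    using that by (rule filter_leD)
  with assms show ?thesis
    unfolding lsc_on_iff_eventually_less by auto
qed

lemma lsc_on_diff_usc_on:
  fixes p :: "'a::topological_space \<Rightarrow> real"
  assumes u: "lsc_on S u" and p: "usc_on S (\<lambda>x. ereal (p x))" and e: "e > 0"
  shows "lsc_on S (\<lambda>x. u x - ereal (e * p x))"
  unfolding lsc_on_iff_eventually_less
proof (intro ballI allI impI)
  fix x a
  assume x: "x \<in> S" and a: "a < u x - ereal (e * p x)"
  \<comment> \<open>Two reals strictly above \<open>a\<close>: their gap is what \<open>\<epsilon> p\<close> may consume near \<open>x\<close>.\<close>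
  obtain b where b: "a < ereal b" "ereal b < u x - ereal (e * p x)"
    using ereal_dense2[OF a] by auto
  obtain c where c: "ereal b < ereal c" "ereal c < u x - ereal (e * p x)"
    using ereal_dense2[OF b(2)] by blast
  have "ereal (c + e * p x) < u x"
    using c(2) by (cases "u x") auto
  then have 1: "\<forall>\<^sub>F y in at x within S. ereal (c + e * p x) < u y"
    using u x by (simp add: lsc_on_iff_eventually_less)
  have "p x < p x + (c - b) / e"
    using c(1) e by simp
  then have 2: "\<forall>\<^sub>F y in at x within S. ereal (p y) < ereal (p x + (c - b) / e)"
    using p x unfolding usc_on_iff_eventually_less by (metis ereal_less_eq(3) less_ereal.simps(1))
  show "\<forall>\<^sub>F y in at x within S. a < u y - ereal (e * p y)"
    using 1 2
  proof eventually_elim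
    case (elim y)
    then have "e * p y < e * p x + (c - b)"
      using e by (simp add: field_simps)
    then have "ereal b < u y - ereal (e * p y)"
      using elim(1) by (cases "u y") auto
    with b(1) show ?case
      by simp
  qed
qed

text \<open>
  Unlike \<open>nn_integral_cmult\<close>, the two facts below do not ask for measurability: \<open>nn_integral\<close> is a
  supremum over simple functions, and a positive real factor permutes these. They make the ball
  mean homogeneous for arbitrary integrands.
\<close>
lemma nn_integral_cmult_ge:
  "c * (\<integral>\<^sup>+y. f y \<partial>M) \<le> (\<integral>\<^sup>+y. c * f y \<partial>M)"
proof -
  have "c * integral\<^sup>S M g \<le> (\<integral>\<^sup>+y. c * f y \<partial>M)" if g: "simple_function M g" "g \<le> f" for g
  proof -
    have "c * integral\<^sup>S M g = (\<integral>\<^sup>Sy. c * g y \<partial>M)"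
      using g(1) by (simp add: simple_integral_mult)
    also have "\<dots> = (\<integral>\<^sup>+y. c * g y \<partial>M)"
      using g(1) by (intro nn_integral_eq_simple_integral[symmetric]) auto
    also have "\<dots> \<le> (\<integral>\<^sup>+y. c * f y \<partial>M)"
      using g(2) by (intro nn_integral_mono mult_left_mono) (auto simp: le_fun_def)
    finally show ?thesis .
  qed
  then show ?thesis
    unfolding nn_integral_def[of M f] by (subst SUP_mult_left_ennreal) (auto intro!: SUP_least)
qed

lemma nn_integral_cmult_pos_real:
  assumes "e > 0"
  shows "(\<integral>\<^sup>+y. ennreal e * f y \<partial>M) = ennreal e * (\<integral>\<^sup>+y. f y \<partial>M)"
proof (rule antisym)
  have inv: "ennreal e * (ennreal (1 / e) * t) = t" "ennreal (1 / e) * (ennreal e * t) = t" for t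
    using assms by (simp_all add: mult.assoc[symmetric] ennreal_mult[symmetric])
  have "ennreal e * (ennreal (1 / e) * (\<integral>\<^sup>+y. ennreal e * f y \<partial>M))
      \<le> ennreal e * (\<integral>\<^sup>+y. ennreal (1 / e) * (ennreal e * f y) \<partial>M)"
    by (intro mult_left_mono nn_integral_cmult_ge) simp
  then show "(\<integral>\<^sup>+y. ennreal e * f y \<partial>M) \<le> ennreal e * (\<integral>\<^sup>+y. f y \<partial>M)"
    by (simp only: inv)
qed (rule nn_integral_cmult_ge)

lemma ball_mean_mono:
  assumes "\<And>y. y \<in> ball x r \<Longrightarrow> f y \<le> g y"
  shows "ball_mean M f x r \<le> ball_mean M g x r"
proof -
  have "(\<integral>\<^sup>+y\<in>ball x r. e2ennreal (f y) \<partial>M) \<le> (\<integral>\<^sup>+y\<in>ball x r. e2ennreal (g y) \<partial>M)"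
    by (intro nn_integral_mono) (auto split: split_indicator intro!: e2ennreal_mono assms)
  moreover have "(\<integral>\<^sup>+y\<in>ball x r. e2ennreal (- g y) \<partial>M) \<le> (\<integral>\<^sup>+y\<in>ball x r. e2ennreal (- f y) \<partial>M)"
    by (intro nn_integral_mono) (auto split: split_indicator intro!: e2ennreal_mono assms)
  ultimately show ?thesis
    unfolding ball_mean_def
    by (intro ereal_mult_left_mono ereal_minus_mono) (simp_all add: less_eq_ennreal.rep_eq)
qed

lemma e2ennreal_cmult:
  assumes "e > 0"
  shows "e2ennreal (ereal e * t) = ennreal e * e2ennreal t"
proof (cases "0 \<le> t")
  case True
  then show ?thesis
    using assms by (cases t) (auto simp: ennreal_mult ennreal_mult_top)
next
  case False
  then have "ereal e * t \<le> 0"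
    using assms by (simp add: ereal_mult_le_0_iff)
  with False show ?thesis
    by (simp add: e2ennreal_neg)
qed

lemma ball_mean_cmult:
  assumes e: "e > 0"
  shows "ball_mean M (\<lambda>y. ereal e * f y) x r = ereal e * ball_mean M f x r"
proof -
  have I: "enn2ereal (\<integral>\<^sup>+y\<in>ball x r. e2ennreal (ereal e * g y) \<partial>M)
      = ereal e * enn2ereal (\<integral>\<^sup>+y\<in>ball x r. e2ennreal (g y) \<partial>M)" for g
    using e by (simp add: e2ennreal_cmult mult.assoc nn_integral_cmult_pos_real times_ennreal.rep_eq)
  have D: "ereal e * s - ereal e * t = ereal e * (s - t)" for s t
    using e by (cases s; cases t) (auto simp: algebra_simps)
  show ?thesis
    using I[of f] I[of "\<lambda>y. - f y"]
    by (simp add: ball_mean_def D mult.left_commute)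
qed

text \<open>
  A function that is touched from below at \<open>x\<close> by a translate of a positive multiple of \<open>\<phi>\<close>
  inherits a positive lower Laplacian from \<open>\<phi>\<close>: for small radii the ball means compare, since the
  balls lie in \<open>\<Omega>\<close>.
\<close>
lemma touching_laplacian_pos:
  assumes "open \<Omega>" "x \<in> \<Omega>" and e: "e > 0"
    and touch: "\<And>y. y \<in> \<Omega> \<Longrightarrow> ereal e * (\<phi> y - \<phi> x) \<le> u y - u x"
    and pos: "lower_amv_laplacian M \<phi> x > 0"
  shows "lower_amv_laplacian M u x > 0"
proof -
  let ?Q = "\<lambda>f r. ereal (1 / r\<^sup>2) * ball_mean M (\<lambda>y. f y - f x) x r"
  obtain c where c: "0 < ereal c" "ereal c < Liminf (at_right 0) (?Q \<phi>)"
    using ereal_dense2[OF pos] unfolding lower_amv_laplacian_def by auto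
  then have ev: "\<forall>\<^sub>F r in at_right 0. ereal c < ?Q \<phi> r"
    using le_Liminf_iff[THEN iffD1, OF order_refl] by blast
  obtain d where d: "d > 0" "ball x d \<subseteq> \<Omega>"
    using assms(1,2) openE by blast
  have "\<forall>\<^sub>F r in at_right 0. r < d"
    using d(1) by (auto simp: eventually_at_right_field)
  with ev have "\<forall>\<^sub>F r in at_right 0. ereal (e * c) \<le> ?Q u r"
  proof eventually_elim
    case (elim r)
    have sub: "ball x r \<subseteq> \<Omega>"
      using elim(2) d(2) by auto
    have "ereal (e * c) = ereal e * ereal c"
      by simp
    also have "\<dots> \<le> ereal e * ?Q \<phi> r"
      using elim(1) e by (intro ereal_mult_left_mono) auto
    also have "\<dots> = ereal (1 / r\<^sup>2) * ball_mean M (\<lambda>y. ereal e * (\<phi> y - \<phi> x)) x r"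
      using e by (simp add: ball_mean_cmult mult.left_commute)
    also have "\<dots> \<le> ?Q u r"
      using sub touch by (intro ereal_mult_left_mono ball_mean_mono) auto
    finally show ?case .
  qed
  then have "ereal (e * c) \<le> lower_amv_laplacian M u x"
    unfolding lower_amv_laplacian_def by (rule Liminf_bounded)
  moreover have "0 < ereal (e * c)"
    using c(1) e by simp
  ultimately show ?thesis
    by (rule less_le_trans[rotated])
qed

text \<open>
  At an interior point with finite minimal value, minimality of \<open>u\<close> only gives a Laplacian that is
  at least 0, which does not contradict the hypothesis on \<open>u\<close>. Minimising \<open>u - \<epsilon> \<phi>\<close> instead makes
  the inequality strict at the new minimum point.
\<close>
lemma frontier_min_le:
  assumes open_\<Omega>: "open \<Omega>" and cpt: "compact (closure \<Omega>)" and ne: "\<Omega> \<noteq> {}"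
    and u: "lsc_on (closure \<Omega>) u"
    and lap_u: "\<And>x. x \<in> \<Omega> \<Longrightarrow> lower_amv_laplacian M u x \<le> 0"
    and bdd: "\<And>x. x \<in> closure \<Omega> \<Longrightarrow> \<bar>\<phi> x\<bar> \<le> ereal C"
    and \<phi>: "usc_on (closure \<Omega>) \<phi>"
    and lap_\<phi>: "\<And>x. x \<in> \<Omega> \<Longrightarrow> lower_amv_laplacian M \<phi> x > 0"
  obtains x where "x \<in> frontier \<Omega>" "\<And>z. z \<in> closure \<Omega> \<Longrightarrow> u x \<le> u z"
proof (rule ccontr)
  assume "\<not> thesis"
  with that have no_min: "\<And>x. x \<in> frontier \<Omega> \<Longrightarrow> \<exists>z\<in>closure \<Omega>. u z < u x"
    by (meson not_le)
  have cl: "closure \<Omega> = \<Omega> \<union> frontier \<Omega>"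
    by (simp add: closure_Un_frontier)
  obtain m where m: "m \<in> closure \<Omega>" "\<And>z. z \<in> closure \<Omega> \<Longrightarrow> u m \<le> u z"
    using lsc_on_compact_attains_min[OF cpt _ u] ne by auto
  have above: "u m < u z" if "z \<in> frontier \<Omega>" for z
    using no_min[OF that] m(2) by (meson le_less_trans)
  then have m_in: "m \<in> \<Omega>"
    using m(1) cl by auto
  have no_touch: False
    if "x \<in> \<Omega>" "e > 0" "\<And>y. y \<in> \<Omega> \<Longrightarrow> ereal e * (\<phi> y - \<phi> x) \<le> u y - u x" for x e
    using touching_laplacian_pos[OF open_\<Omega> that lap_\<phi>[OF that(1)]] lap_u[OF that(1)] by simp
  have "\<bar>u m\<bar> \<noteq> \<infinity>"
  proof
    assume inf: "\<bar>u m\<bar> = \<infinity>"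
    have "u y - u m = \<infinity>" if "y \<in> \<Omega>" for y
      using inf m(2)[of y] that cl by (cases "u m"; cases "u y") auto
    then show False
      using no_touch[OF m_in, of 1] by simp
  qed
  then obtain a where a: "u m = ereal a"
    by auto
  define p where "p x = real_of_ereal (\<phi> x)" for x
  have p: "\<phi> x = ereal (p x)" "\<bar>p x\<bar> \<le> C" if "x \<in> closure \<Omega>" for x
    using bdd[OF that] by (cases "\<phi> x"; simp add: p_def)+
  have C: "C \<ge> 0"
    using p(2)[OF m(1)] by simp
  have "\<exists>d>0. \<forall>z\<in>frontier \<Omega>. ereal (a + d) < u z"
  proof (cases "frontier \<Omega> = {}")
    case True
    then show ?thesis
      by (intro exI[of _ 1]) auto
  next
    case False
    have sub: "frontier \<Omega> \<subseteq> closure \<Omega>"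
      using cl by auto
    have "compact (frontier \<Omega>)"
      using compact_Int_closed[OF cpt frontier_closed, of \<Omega>] sub by (simp add: Int_absorb1)
    then obtain z where z: "z \<in> frontier \<Omega>" "\<And>y. y \<in> frontier \<Omega> \<Longrightarrow> u z \<le> u y"
      using lsc_on_compact_attains_min False lsc_on_subset[OF u sub] by metis
    obtain b where b: "ereal a < ereal b" "ereal b < u z"
      using ereal_dense2 above[OF z(1)] a by metis
    then show ?thesis
      using z(2) by (intro exI[of _ "b - a"]) (auto intro: less_le_trans)
  qed
  then obtain d where d: "d > 0" "\<And>z. z \<in> frontier \<Omega> \<Longrightarrow> ereal (a + d) < u z"
    by auto
  \<comment> \<open>\<open>\<epsilon> p\<close> oscillates by at most \<open>2 \<epsilon> C < d\<close>, less than the gap between the frontier and the minimum.\<close>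
  define e where "e = d / (2 * C + 1)"
  have e: "e > 0" "e * (2 * C) < d"
    using d(1) C by (simp_all add: e_def field_simps)
  let ?w = "\<lambda>x. u x - ereal (e * p x)"
  have "usc_on (closure \<Omega>) (\<lambda>x. ereal (p x))"
    unfolding usc_on_iff_eventually_less
  proof (intro ballI allI impI)
    fix x t
    assume x: "x \<in> closure \<Omega>" and t: "ereal (p x) < t"
    have "\<forall>\<^sub>F y in at x within closure \<Omega>. \<phi> y < t"
      using \<phi> x t p(1)[OF x] by (simp add: usc_on_iff_eventually_less)
    moreover have "\<forall>\<^sub>F y in at x within closure \<Omega>. y \<in> closure \<Omega>"
      by (simp add: eventually_at_filter)
    ultimately show "\<forall>\<^sub>F y in at x within closure \<Omega>. ereal (p y) < t"
      by eventually_elim (simp add: p(1))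
  qed
  with u have "lsc_on (closure \<Omega>) ?w"
    using e(1) by (rule lsc_on_diff_usc_on)
  from lsc_on_compact_attains_min[OF cpt _ this] obtain x
    where x: "x \<in> closure \<Omega>" "\<And>z. z \<in> closure \<Omega> \<Longrightarrow> ?w x \<le> ?w z"
    using ne by auto
  have "x \<notin> frontier \<Omega>"
  proof
    assume "x \<in> frontier \<Omega>"
    then have "ereal (a + d) < u x"
      by (rule d(2))
    moreover have "e * (p x - p m) \<le> e * (2 * C)"
      using p(2)[OF x(1)] p(2)[OF m(1)] e(1) by (intro mult_left_mono) auto
    then have "e * p x - e * p m < d"
      using e(2) by (simp add: right_diff_distrib)
    ultimately have "?w m < ?w x"
      using a by (cases "u x") auto
    with x(2)[OF m(1)] show False
      by simp
  qed
  then have x_in: "x \<in> \<Omega>"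
    using x(1) cl by auto
  obtain b where b: "u x = ereal b"
    using x(2)[OF m(1)] m(2)[OF x(1)] a by (cases "u x") auto
  have "ereal e * (\<phi> y - \<phi> x) \<le> u y - u x" if "y \<in> \<Omega>" for y
  proof -
    have y: "y \<in> closure \<Omega>"
      using that cl by auto
    show ?thesis
      using x(2)[OF y] p(1)[OF y] p(1)[OF x(1)] b by (cases "u y") (auto simp: right_diff_distrib)
  qed
  then show False
    using no_touch[OF x_in e(1)] by blast
qed

theorem corollary4p6:
  fixes M :: "'a::metric_space measure"
    and \<Omega> :: "'a set"
    and u :: "'a \<Rightarrow> ereal"
  assumes "metric_measure_space M"
    and "proper_space TYPE('a)"
    and "domain \<Omega>" and "bounded \<Omega>"
    and "L1_loc M \<Omega> u" and "precise_on M \<Omega> u"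
    and "lsc_on (closure \<Omega>) u"
    and "\<forall>x\<in>\<Omega>. lower_amv_laplacian M u x \<le> 0"
    and "\<exists>\<phi> :: 'a \<Rightarrow> ereal.
           (\<exists>C::real. \<forall>x\<in>closure \<Omega>. \<bar>\<phi> x\<bar> \<le> ereal C) \<and>
           usc_on (closure \<Omega>) \<phi> \<and> precise_on M \<Omega> \<phi> \<and>
           (\<forall>x\<in>\<Omega>. lower_amv_laplacian M \<phi> x > 0)"
  shows "\<exists>x y. is_arg_min u (\<lambda>z. z \<in> frontier \<Omega>) x \<and>
               is_arg_min u (\<lambda>z. z \<in> closure \<Omega>) y \<and>
               u x = u y"
proof -
  have "compact (closure \<Omega>)"
    using assms(2,4) by (simp add: proper_space_def bounded_closure)
  moreover have "open \<Omega>" "\<Omega> \<noteq> {}"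
    using assms(3) by (auto simp: domain_def)
  ultimately obtain x where x: "x \<in> frontier \<Omega>" "\<And>z. z \<in> closure \<Omega> \<Longrightarrow> u x \<le> u z"
    using frontier_min_le[of \<Omega> u M] assms(7-9) by metis
  have "frontier \<Omega> \<subseteq> closure \<Omega>"
    by (simp add: frontier_def)
  with x show ?thesis
    by (intro exI[of _ x]) (auto simp: is_arg_min_linorder)
qed

end
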